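(* Let $S$ be a connected regular surface in the Euclidean space $\mathbb{E}^3$ satisfying the $\mathcal{P}$ property, i.e. such that for each affine plane $\Pi\subset\mathbb{E}^3$ with $\Pi\cap S\neq\emptyset$, the set $\Pi\cap S$ is a circle in $\Pi$ (possibly degenerate, of radius zero). Then $S$ is a Euclidean sphere, i.e. there exist $c\in\mathbb{E}^3$ and $r>0$ such that $S=\{x\in\mathbb{E}^3 : \|x-c\|=r\}$.
   Context: $\mathbb{E}^3$ is $\mathbb{R}^3$ with its standard Euclidean inner product. A regular surface is a nonempty smooth embedded $2$-dimensional submanifold of $\mathbb{E}^3$ (without boundary) in the usual sense of classical differential geometry; it is not assumed to be complete, compact or closed as a subset. A circle in an affine plane $\Pi$ is a set of the form $\{x\in\Pi : \|x-p\|=\rho\}$ with $p\in\Pi$ and $\rho\ge 0$; the degenerate case $\rho=0$ is a single point. *)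

theory Defs
  imports "HOL-Analysis.Analysis"
begin

text \<open>Class \<open>C\<^sup>k\<close> on an open set: for finite-dimensional domains it suffices to ask that all
  directional derivatives in constant directions be of class \<open>C\<^sup>k\<^sup>-\<^sup>1\<close>. The definitions are only
  meant for open \<open>U\<close>, since derivatives are taken at points of \<open>U\<close> and not within \<open>U\<close>.\<close>

primrec Ck_on ::
  "nat \<Rightarrow> 'a::euclidean_space set \<Rightarrow> ('a \<Rightarrow> 'b::real_normed_vector) \<Rightarrow> bool"
where
  "Ck_on 0 U f \<longleftrightarrow> continuous_on U f"
| "Ck_on (Suc k) U f \<longleftrightarrow>
     (\<forall>x\<in>U. f differentiable (at x)) \<and>
     (\<forall>v. Ck_on k U (\<lambda>x. frechet_derivative f (at x) v))"

definition smooth_on ::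
  "'a::euclidean_space set \<Rightarrow> ('a \<Rightarrow> 'b::real_normed_vector) \<Rightarrow> bool"
where
  "smooth_on U f \<longleftrightarrow> (\<forall>k. Ck_on k U f)"

text \<open>Smooth embedded surfaces without boundary, in the classical sense of local regular
  parametrizations that are homeomorphisms onto relatively open pieces \<open>S \<inter> V\<close>. The library's
  \<^const>\<open>homeomorphism\<close> takes the inverse map \<open>g\<close> explicitly; no differentiability of \<open>g\<close> is asked.\<close>

definition regular_surface :: "(real^3) set \<Rightarrow> bool"
where
  "regular_surface S \<longleftrightarrow>
     S \<noteq> {} \<and>
     (\<forall>p\<in>S. \<exists>(U :: (real^2) set) V \<phi> g.
        open U \<and> open V \<and> p \<in> V \<and>
        homeomorphism U (S \<inter> V) \<phi> g \<and>
        smooth_on U \<phi> \<and>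
        (\<forall>u\<in>U. inj (frechet_derivative \<phi> (at u))))"

definition affine_plane :: "(real^3) set \<Rightarrow> bool"
where
  "affine_plane H \<longleftrightarrow> affine H \<and> aff_dim H = 2"

definition circle_in :: "(real^3) set \<Rightarrow> (real^3) set \<Rightarrow> bool"
where
  "circle_in H C \<longleftrightarrow> (\<exists>p\<in>H. \<exists>\<rho>\<ge>0. C = {x\<in>H. norm (x - p) = \<rho>})"

definition P_property :: "(real^3) set \<Rightarrow> bool"
where
  "P_property S \<longleftrightarrow>
     (\<forall>H. affine_plane H \<and> H \<inter> S \<noteq> {} \<longrightarrow> circle_in H (H \<inter> S))"

end

theory Submission
  imports Defs
begin

text \<open>Smoothness and connectedness enter only through the fact that \<open>S\<close> has two distinct points
  \<open>m + a\<close> and \<open>m - a\<close>. Two perpendicular planes through them cut \<open>S\<close> in circles sharing these two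
  points, so both circles lie on one sphere. Since \<open>m\<close> is strictly inside both circles, every plane
  through \<open>m\<close> that does not contain the line of direction \<open>a\<close> meets each circle in two points;
  the section of \<open>S\<close> by that plane shares four non-collinear points with the sphere and
  therefore coincides with the section of the sphere. Every point off the line lies on such a plane.\<close>

lemma regular_surface_two_points:
  assumes "regular_surface S"
  obtains x y where "x \<in> S" "y \<in> S" "x \<noteq> y"
proof -
  from assms obtain p where p: "p \<in> S"
    and ex: "\<exists>(U :: (real^2) set) V \<phi> g. open U \<and> open V \<and> p \<in> V \<and> homeomorphism U (S \<inter> V) \<phi> g"
    unfolding regular_surface_def by blast
  from ex obtain U :: "(real^2) set" and V \<phi> g
    where U: "open U" "p \<in> V" and hom: "homeomorphism U (S \<inter> V) \<phi> g"
    by blast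
  have "U \<noteq> {}"
    using hom p U by (auto simp: homeomorphism_def)
  then have "infinite U"
    using U(1) finite_imp_not_open by blast
  then obtain u v where "u \<in> U" "v \<in> U" "u \<noteq> v"
    by (metis finite.simps insertI1 subsetI subset_singleton_iff singletonD)
  then show ?thesis
    using that[of "\<phi> u" "\<phi> v"] hom unfolding homeomorphism_def by (metis Int_iff imageI)
qed

text \<open>Squaring the norm equation of the circle gives this form: \<open>p\<close> is the centre
  relative to \<open>m\<close>, and \<open>k\<close> is the negative of the power of
  \<open>m\<close>. The point \<open>m + z\<close> ensures that the plane meets \<open>S\<close>.
  Constants in this form can be compared between planes through \<open>m\<close>.\<close>

lemma P_property_section:
  fixes S :: "(real^3) set"
  assumes "P_property S" "n \<noteq> 0" "m + z \<in> S" "n \<bullet> z = 0"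
  obtains p k where "\<And>y. n \<bullet> y = 0 \<Longrightarrow> m + y \<in> S \<longleftrightarrow> y \<bullet> y - 2 * (p \<bullet> y) = k"
proof -
  define H where "H = {x. n \<bullet> x = n \<bullet> m}"
  have "affine_plane H"
    unfolding affine_plane_def H_def
    using assms(2) by (auto simp: aff_dim_hyperplane affine_hyperplane)
  moreover have "m + z \<in> H \<inter> S"
    using assms by (simp add: H_def inner_add_right)
  ultimately have "circle_in H (H \<inter> S)"
    using assms(1) unfolding P_property_def by blast
  then obtain q \<rho> where q: "\<rho> \<ge> 0" "H \<inter> S = {x\<in>H. norm (x - q) = \<rho>}"
    unfolding circle_in_def by blast
  let ?p = "q - m"
  have "m + y \<in> S \<longleftrightarrow> y \<bullet> y - 2 * (?p \<bullet> y) = \<rho>\<^sup>2 - ?p \<bullet> ?p" if "n \<bullet> y = 0" for y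
  proof -
    have "m + y \<in> H"
      using that by (simp add: H_def inner_add_right)
    then have "m + y \<in> S \<longleftrightarrow> norm (m + y - q) = \<rho>"
      using q(2) by blast
    also have "\<dots> \<longleftrightarrow> (norm (y - ?p))\<^sup>2 = \<rho>\<^sup>2"
      using q(1) by (simp add: algebra_simps)
    also have "\<dots> \<longleftrightarrow> y \<bullet> y - 2 * (?p \<bullet> y) = \<rho>\<^sup>2 - ?p \<bullet> ?p"
      by (auto simp: power2_norm_eq_inner inner_diff_left inner_diff_right inner_commute)
    finally show ?thesis .
  qed
  then show ?thesis
    by (rule that)
qed

text \<open>The product of the roots of the first equation is \<open>- s / A < 0\<close>, so there
  are two distinct real roots. Subtracting the two equations leaves an equation linear in
  \<open>t\<close> that holds at both roots, so its coefficients vanish.\<close>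

lemma quadratic_roots_determine_coefficients:
  fixes A B B' k s :: real
  assumes "A > 0" "s > 0"
    and roots: "\<And>t. A * t\<^sup>2 - 2 * B * t = s \<Longrightarrow> A * t\<^sup>2 - 2 * B' * t = k"
  shows "B' = B" "k = s"
proof -
  define d where "d = sqrt (B\<^sup>2 + A * s)"
  have d: "d\<^sup>2 = B\<^sup>2 + A * s" "d > 0"
    using assms by (auto simp: d_def add_nonneg_pos)
  \<comment> \<open>Both roots at once: \<open>e\<close> will be \<open>d\<close> and
    \<open>- d\<close>.\<close>
  have root: "A * ((B + e) / A)\<^sup>2 - 2 * B * ((B + e) / A) = s" if "e\<^sup>2 = d\<^sup>2" for e
  proof -
    have "A * ((B + e) / A)\<^sup>2 - 2 * B * ((B + e) / A) = (e\<^sup>2 - B\<^sup>2) / A"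
      using assms(1) by (simp add: field_simps power2_eq_square)
    then show ?thesis
      using that d(1) assms(1) by simp
  qed
  have lin: "2 * (B - B') * ((B + e) / A) = k - s" if "e\<^sup>2 = d\<^sup>2" for e
    using root[OF that] roots[OF root[OF that]] by (simp add: algebra_simps)
  have "2 * (B - B') * ((B + d) / A) = 2 * (B - B') * ((B + - d) / A)"
    using lin[of d] lin[of "- d"] by simp
  then show "B' = B"
    using assms(1) d(2) by (auto simp: field_simps)
  then show "k = s"
    using lin[of d] by simp
qed

lemma orthogonal_frame_3:
  fixes a :: "real^3"
  assumes "a \<noteq> 0"
  obtains u v where "u \<noteq> 0" "v \<noteq> 0" "a \<bullet> u = 0" "a \<bullet> v = 0" "u \<bullet> v = 0"
    "\<And>y. \<exists>\<alpha> \<beta> \<gamma>. y = \<alpha> *\<^sub>R a + \<beta> *\<^sub>R u + \<gamma> *\<^sub>R v"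
proof -
  obtain B where B: "0 \<notin> B" "a \<in> B" "pairwise orthogonal B" "finite B" "card B = 3" "span B = UNIV"
    using vector_in_orthogonal_basis[OF assms] by auto
  have "card (B - {a}) = 2"
    using B by simp
  then obtain u v where uv: "B - {a} = {u, v}" "u \<noteq> v"
    by (auto simp: card_2_iff)
  then have Beq: "B = {a, u, v}" and "u \<noteq> a" "v \<noteq> a"
    using B(2) by auto
  show ?thesis
  proof (rule that)
    show "u \<noteq> 0" "v \<noteq> 0"
      using B(1) Beq by auto
    show "a \<bullet> u = 0" "a \<bullet> v = 0" "u \<bullet> v = 0"
      using B(3) Beq uv \<open>u \<noteq> a\<close> \<open>v \<noteq> a\<close> by (auto simp: pairwise_def orthogonal_def)
    show "\<exists>\<alpha> \<beta> \<gamma>. y = \<alpha> *\<^sub>R a + \<beta> *\<^sub>R u + \<gamma> *\<^sub>R v" for y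
    proof -
      have "y \<in> span {a, u, v}"
        using B(6) Beq by simp
      then obtain \<alpha> \<beta> \<gamma> where "y - \<alpha> *\<^sub>R a - \<beta> *\<^sub>R u - \<gamma> *\<^sub>R v = 0"
        unfolding span_insert span_empty by auto
      then have "y = \<alpha> *\<^sub>R a + \<beta> *\<^sub>R u + \<gamma> *\<^sub>R v"
        by (simp add: algebra_simps)
      then show ?thesis
        by blast
    qed
  qed
qed

text \<open>The equation describes a sphere centred at \<open>m + c\<close> with respect to which
  \<open>m\<close> has power \<open>- (a \<bullet> a)\<close>. This power is negative, so every line
  through \<open>m\<close> meets the sphere in two points.\<close>

lemma P_property_two_points_sphere:
  fixes S :: "(real^3) set"
  assumes P: "P_property S" and "a \<noteq> 0" and a: "m + a \<in> S" "m - a \<in> S"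
  obtains c where "\<And>y. m + y \<in> S \<longleftrightarrow> y \<bullet> y - 2 * (c \<bullet> y) = a \<bullet> a"
proof -
  obtain u v where nz: "u \<noteq> 0" "v \<noteq> 0" and orth: "a \<bullet> u = 0" "a \<bullet> v = 0" "u \<bullet> v = 0"
    and frame: "\<And>y. \<exists>\<alpha> \<beta> \<gamma>. y = \<alpha> *\<^sub>R a + \<beta> *\<^sub>R u + \<gamma> *\<^sub>R v"
    using orthogonal_frame_3[OF \<open>a \<noteq> 0\<close>] by blast
  have orth': "u \<bullet> a = 0" "v \<bullet> a = 0" "v \<bullet> u = 0"
    using orth by (simp_all add: inner_commute)
  have s: "a \<bullet> a > 0"
    using \<open>a \<noteq> 0\<close> by simp
  have circle: "\<exists>p. p \<bullet> a = 0 \<and> (\<forall>y. n \<bullet> y = 0 \<longrightarrow> (m + y \<in> S \<longleftrightarrow> y \<bullet> y - 2 * (p \<bullet> y) = a \<bullet> a))"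
    if n: "n \<noteq> 0" "n \<bullet> a = 0" for n
  proof -
    obtain p k where pk: "\<And>y. n \<bullet> y = 0 \<Longrightarrow> m + y \<in> S \<longleftrightarrow> y \<bullet> y - 2 * (p \<bullet> y) = k"
      using P_property_section[OF P n(1) a(1) n(2)] by blast
    \<comment> \<open>The points \<open>a\<close> and \<open>- a\<close> give the equations
      \<open>a \<bullet> a - 2 * (p \<bullet> a) = k\<close> and
      \<open>a \<bullet> a + 2 * (p \<bullet> a) = k\<close>. Hence all planes through the chord
      share the constant \<open>a \<bullet> a\<close>.\<close>
    have "p \<bullet> a = 0 \<and> k = a \<bullet> a"
      using pk[of a] pk[of "- a"] n(2) a by simp
    then show ?thesis
      using pk by auto
  qed
  obtain p where p: "p \<bullet> a = 0"
    "\<And>y. v \<bullet> y = 0 \<Longrightarrow> m + y \<in> S \<longleftrightarrow> y \<bullet> y - 2 * (p \<bullet> y) = a \<bullet> a"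
    using circle[of v] nz orth' by blast
  obtain q where q: "q \<bullet> a = 0"
    "\<And>y. u \<bullet> y = 0 \<Longrightarrow> m + y \<in> S \<longleftrightarrow> y \<bullet> y - 2 * (q \<bullet> y) = a \<bullet> a"
    using circle[of u] nz orth' by blast
  \<comment> \<open>The sphere must contain both circles: \<open>c\<close> has to agree with
    \<open>p\<close> on the span of \<open>a\<close> and \<open>u\<close>, and with \<open>q\<close>
    on the span of \<open>a\<close> and \<open>v\<close>.\<close>
  define c where "c = (p \<bullet> u / (u \<bullet> u)) *\<^sub>R u + (q \<bullet> v / (v \<bullet> v)) *\<^sub>R v"
  have c: "c \<bullet> a = 0" "c \<bullet> u = p \<bullet> u" "c \<bullet> v = q \<bullet> v"
    using nz orth orth' by (simp_all add: c_def inner_add_left)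
  have "m + y \<in> S \<longleftrightarrow> y \<bullet> y - 2 * (c \<bullet> y) = a \<bullet> a" for y
  proof (cases "\<exists>t. y = t *\<^sub>R a")
    case True
    then show ?thesis
      using p c orth' by auto
  next
    case False
    then have "y \<noteq> 0"
      by (metis scaleR_zero_left)
    \<comment> \<open>The part of \<open>a\<close> orthogonal to \<open>y\<close>: the plane through
      \<open>m\<close> with normal \<open>n\<close> contains \<open>m + y\<close> but not the
      direction \<open>a\<close>.\<close>
    define n where "n = a - (a \<bullet> y / (y \<bullet> y)) *\<^sub>R y"
    have ny: "n \<bullet> y = 0"
      using \<open>y \<noteq> 0\<close> by (simp add: n_def inner_diff_left)
    have "n \<noteq> 0"
    proof
      assume "n = 0"
      then have eq: "a = (a \<bullet> y / (y \<bullet> y)) *\<^sub>R y"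
        by (simp add: n_def)
      then have "a \<bullet> y / (y \<bullet> y) \<noteq> 0"
        using \<open>a \<noteq> 0\<close> by (metis scaleR_zero_left)
      then have "y = inverse (a \<bullet> y / (y \<bullet> y)) *\<^sub>R a"
        by (subst (2) eq) simp
      then show False
        using False by blast
    qed
    have "n \<bullet> a = n \<bullet> n"
      using ny by (subst (3) n_def) (simp add: inner_diff_right)
    then have na: "n \<bullet> a \<noteq> 0"
      using \<open>n \<noteq> 0\<close> by simp
    \<comment> \<open>Shearing along \<open>a\<close> keeps \<open>u'\<close> and \<open>v'\<close>
      in the planes of the two circles and moves them into the plane orthogonal to \<open>n\<close>.
      They direct the lines in which that plane cuts the other two.\<close>
    define u' where "u' = u - (n \<bullet> u / (n \<bullet> a)) *\<^sub>R a"
    define v' where "v' = v - (n \<bullet> v / (n \<bullet> a)) *\<^sub>R a"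
    have n': "n \<bullet> u' = 0" "n \<bullet> v' = 0"
      using na by (simp_all add: u'_def v'_def inner_diff_right)
    have perp: "v \<bullet> u' = 0" "u \<bullet> v' = 0"
      using orth orth' by (simp_all add: u'_def v'_def inner_diff_right)
    have "u \<bullet> u' = u \<bullet> u" "v \<bullet> v' = v \<bullet> v"
      using orth' by (simp_all add: u'_def v'_def inner_diff_right)
    then have "u' \<noteq> 0" "v' \<noteq> 0"
      using nz by auto
    have c': "c \<bullet> u' = p \<bullet> u'" "c \<bullet> v' = q \<bullet> v'"
      using c p(1) q(1) by (simp_all add: u'_def v'_def inner_diff_right)
    have on_u': "m + t *\<^sub>R u' \<in> S \<longleftrightarrow> (u' \<bullet> u') * t\<^sup>2 - 2 * (c \<bullet> u') * t = a \<bullet> a" for t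
      using p(2)[of "t *\<^sub>R u'"] perp c' by (simp add: power2_eq_square algebra_simps)
    have on_v': "m + t *\<^sub>R v' \<in> S \<longleftrightarrow> (v' \<bullet> v') * t\<^sup>2 - 2 * (c \<bullet> v') * t = a \<bullet> a" for t
      using q(2)[of "t *\<^sub>R v'"] perp c' by (simp add: power2_eq_square algebra_simps)
    have "\<exists>t. m + t *\<^sub>R u' \<in> S"
    proof (rule ccontr)
      assume no: "\<nexists>t. m + t *\<^sub>R u' \<in> S"
      \<comment> \<open>Without a root the hypothesis on roots holds vacuously, so the lemma would
        identify \<open>c \<bullet> u'\<close> with any other number.\<close>
      have "c \<bullet> u' + 1 = c \<bullet> u'"
        by (rule quadratic_roots_determine_coefficients(1)[of "u' \<bullet> u'" "a \<bullet> a" "c \<bullet> u'" _ 0])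
          (use \<open>u' \<noteq> 0\<close> s no on_u' in auto)
      then show False
        by simp
    qed
    then obtain t0 where "m + t0 *\<^sub>R u' \<in> S"
      by blast
    then obtain r k where rk: "\<And>x. n \<bullet> x = 0 \<Longrightarrow> m + x \<in> S \<longleftrightarrow> x \<bullet> x - 2 * (r \<bullet> x) = k"
      using P_property_section[OF P \<open>n \<noteq> 0\<close>, of m "t0 *\<^sub>R u'"] n' by auto
    have rk': "m + t *\<^sub>R w \<in> S \<longleftrightarrow> (w \<bullet> w) * t\<^sup>2 - 2 * (r \<bullet> w) * t = k" if "n \<bullet> w = 0" for t w
      using rk[of "t *\<^sub>R w"] that by (simp add: power2_eq_square algebra_simps)
    \<comment> \<open>On this line the sphere's points belong to \<open>S\<close>, hence to the
      section by the new plane. Comparing coefficients then shows that \<open>r\<close> and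
      \<open>c\<close> agree on \<open>u'\<close>, and likewise on \<open>v'\<close>.\<close>
    have u_roots: "(u' \<bullet> u') * t\<^sup>2 - 2 * (r \<bullet> u') * t = k"
      if "(u' \<bullet> u') * t\<^sup>2 - 2 * (c \<bullet> u') * t = a \<bullet> a" for t
      using that on_u' rk'[OF n'(1)] by blast
    have v_roots: "(v' \<bullet> v') * t\<^sup>2 - 2 * (r \<bullet> v') * t = k"
      if "(v' \<bullet> v') * t\<^sup>2 - 2 * (c \<bullet> v') * t = a \<bullet> a" for t
      using that on_v' rk'[OF n'(2)] by blast
    have "u' \<bullet> u' > 0" "v' \<bullet> v' > 0"
      using \<open>u' \<noteq> 0\<close> \<open>v' \<noteq> 0\<close> by simp_all
    then have ru: "r \<bullet> u' = c \<bullet> u'" "k = a \<bullet> a" and rv: "r \<bullet> v' = c \<bullet> v'"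
      using quadratic_roots_determine_coefficients[OF _ s u_roots]
        quadratic_roots_determine_coefficients(1)[OF _ s v_roots] by blast+
    obtain \<alpha> \<beta> \<gamma> where y: "y = \<alpha> *\<^sub>R a + \<beta> *\<^sub>R u + \<gamma> *\<^sub>R v"
      using frame by blast
    \<comment> \<open>The \<open>a\<close>-coordinate of \<open>y\<close> in the frame
      \<open>a\<close>, \<open>u'\<close>, \<open>v'\<close>. It vanishes since \<open>n\<close> is
      orthogonal to \<open>y\<close>, \<open>u'\<close> and \<open>v'\<close> but not to
      \<open>a\<close>, so \<open>r\<close> and \<open>c\<close> agree on \<open>y\<close>.\<close>
    define \<delta> where "\<delta> = \<alpha> + \<beta> * (n \<bullet> u / (n \<bullet> a)) + \<gamma> * (n \<bullet> v / (n \<bullet> a))"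
    have y': "y = \<delta> *\<^sub>R a + \<beta> *\<^sub>R u' + \<gamma> *\<^sub>R v'"
      by (simp add: y u'_def v'_def \<delta>_def algebra_simps)
    then have "\<delta> = 0"
      using ny n' na by (simp add: inner_add_right)
    then have "r \<bullet> y = c \<bullet> y"
      using y' ru rv by (simp add: inner_add_right)
    then show ?thesis
      using rk[OF ny] ru(2) by simp
  qed
  then show ?thesis
    by (rule that)
qed

theorem theorem1p1:
  fixes S :: "(real^3) set"
  assumes "regular_surface S"
    and "connected S"
    and "P_property S"
  shows "\<exists>c r. r > 0 \<and> S = {x. norm (x - c) = r}"
proof -
  obtain x y where xy: "x \<in> S" "y \<in> S" "x \<noteq> y"
    using regular_surface_two_points[OF assms(1)] by blast
  define m a where "m = (1/2) *\<^sub>R (x + y)" and "a = (1/2) *\<^sub>R (x - y)"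
  have "m + a = x" "m - a = y"
    by (simp_all add: m_def a_def algebra_simps flip: scaleR_add_left)
  moreover have "a \<noteq> 0"
    using xy by (simp add: a_def)
  ultimately obtain c where c: "\<And>y. m + y \<in> S \<longleftrightarrow> y \<bullet> y - 2 * (c \<bullet> y) = a \<bullet> a"
    using P_property_two_points_sphere[OF assms(3), of a m] xy by auto
  \<comment> \<open>Completing the square gives centre \<open>m + c\<close> and this radius.\<close>
  define r where "r = sqrt (a \<bullet> a + c \<bullet> c)"
  have "a \<bullet> a + c \<bullet> c > 0"
    using \<open>a \<noteq> 0\<close> by (simp add: add_pos_nonneg)
  then have r: "r > 0" "r\<^sup>2 = a \<bullet> a + c \<bullet> c"
    by (simp_all add: r_def)
  have "z \<in> S \<longleftrightarrow> norm (z - (m + c)) = r" for z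
  proof -
    have "norm (z - (m + c)) = r \<longleftrightarrow> (norm ((z - m) - c))\<^sup>2 = r\<^sup>2"
      using r(1) by (simp add: algebra_simps)
    also have "\<dots> \<longleftrightarrow> (z - m) \<bullet> (z - m) - 2 * (c \<bullet> (z - m)) = a \<bullet> a"
      unfolding r(2) power2_norm_eq_inner inner_diff_left[of "z - m" c] inner_diff_right[of _ "z - m" c]
        inner_commute[of "z - m" c] by auto
    also have "\<dots> \<longleftrightarrow> z \<in> S"
      using c[of "z - m"] by simp
    finally show ?thesis by blast
  qed
  then show ?thesis
    using r(1) by blast
qed

end
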